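(* For every nonzero ternary cubic form $p\in P_{3,3}$, \[ \frac{\|p\|_\infty}{\|p\|_B}\geq\frac{1}{\sqrt 7}. \] Equality holds if $p=g^*\mathrm{Ch}_{3,3}$ for some $g\in CO(3)$, where $\mathrm{Ch}_{3,3}(x)=x_1^3-3x_1(x_2^2+x_3^2)$.
   Context: $P_{d,n}$ denotes the real vector space of homogeneous polynomials (forms) of degree $d$ in $n$ real variables. For $p\in P_{d,n}$, the uniform norm is $\|p\|_\infty=\max_{\|x\|=1}|p(x)|$, where $\|\cdot\|$ is the Euclidean norm. Writing $p(x)=\sum_{|\alpha|=d}c_\alpha x^\alpha$, the Bombieri norm is \[ \|p\|_B=\Big(\sum_{|\alpha|=d}\binom{d}{\alpha}^{-1}|c_\alpha|^2\Big)^{1/2},\qquad \binom{d}{\alpha}=\frac{d!}{\alpha_1!\cdots\alpha_n!}. \] The conformal orthogonal group is $CO(n)=\mathbb{R}_{>0}\times O(n)$. It acts on $P_{d,n}$ by $(g^*p)(x)=s\,p(\rho^{-1}x)$ for $g=(s,\rho)$. *)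

theory Defs
  imports "HOL-Analysis.Analysis"
begin

definition idx3 :: "(nat \<times> nat \<times> nat) set" where
  "idx3 = {(a, b, c). a + b + c = 3}"

text \<open>A ternary cubic form p in P_{3,3}, given by its coefficient function c_alpha
  (coefficients vanish off the degree-3 exponents).\<close>
definition cubic_form :: "(nat \<times> nat \<times> nat \<Rightarrow> real) \<Rightarrow> bool" where
  "cubic_form c \<longleftrightarrow> (\<forall>\<alpha>. \<alpha> \<notin> idx3 \<longrightarrow> c \<alpha> = 0)"

definition eval3 :: "(nat \<times> nat \<times> nat \<Rightarrow> real) \<Rightarrow> real^3 \<Rightarrow> real" where
  "eval3 c x = (\<Sum>(a, b, d)\<in>idx3. c (a, b, d) * (x$1)^a * (x$2)^b * (x$3)^d)"

definition unorm :: "(nat \<times> nat \<times> nat \<Rightarrow> real) \<Rightarrow> real" where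
  "unorm c = (SUP x\<in>sphere 0 1. \<bar>eval3 c x\<bar>)"

definition multinom3 :: "nat \<times> nat \<times> nat \<Rightarrow> real" where
  "multinom3 \<alpha> = (case \<alpha> of (a, b, d) \<Rightarrow> fact 3 / (fact a * fact b * fact d))"

definition bnorm :: "(nat \<times> nat \<times> nat \<Rightarrow> real) \<Rightarrow> real" where
  "bnorm c = sqrt (\<Sum>\<alpha>\<in>idx3. \<bar>c \<alpha>\<bar>^2 / multinom3 \<alpha>)"

text \<open>Action of g = (s, rho) in CO(3) on a form viewed as a function: (g^* p)(x) = s p(rho^{-1} x).\<close>
definition CO_act :: "real \<Rightarrow> (real^3 \<Rightarrow> real^3) \<Rightarrow> (real^3 \<Rightarrow> real) \<Rightarrow> real^3 \<Rightarrow> real" where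
  "CO_act s \<rho> f = (\<lambda>x. s * f (inv \<rho> x))"

definition Ch33 :: "real^3 \<Rightarrow> real" where
  "Ch33 x = (x$1)^3 - 3 * (x$1) * ((x$2)^2 + (x$3)^2)"

end

theory Submission
  imports Defs
begin

text \<open>
  Normalise \<open>p\<close> so that its maximum on the sphere is \<open>p u = 1\<close>, and let \<open>T\<close> be its symmetric
  trilinear form. By Banach's theorem \<open>T x y y \<le> 1\<close> for all unit vectors \<open>x, y\<close>. Complete \<open>u\<close> to an
  orthonormal basis \<open>u, v, w\<close> that diagonalises \<open>T u\<close> on the complement of \<open>u\<close>, with eigenvalues
  \<open>m, n\<close>. Banach's bound for \<open>x\<close> in the plane of \<open>u, v\<close> says that a one-parameter family of
  \<open>3 \<times> 3\<close> matrices is dominated by the identity; eliminating the \<open>u\<close>-direction (a Schur complement)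
  and optimising over the parameter bounds the Frobenius norm of \<open>T v\<close> on the span of \<open>v, w\<close> by a
  function of \<open>m, n\<close>. The same holds with \<open>v\<close> and \<open>w\<close> exchanged, and the sum of the two bounds
  turns into a polynomial inequality on a square, which gives \<open>bnorm p ^ 2 \<le> 7\<close>.

  For the equality case, with \<open>e = \<rho> (axis 1 1)\<close> the transformed polynomial is
  \<open>s (4 (x \<bullet> e)^3 - 3 (x \<bullet> e) (x \<bullet> x))\<close>, whose maximum is at most \<open>s\<close> and whose Bombieri norm is
  read off from its coefficients.
\<close>

section \<open>Real inequalities\<close>

text \<open>Later applied with \<open>C = 0\<close>: near an extremum the increment is a nonnegative
  quadratic without constant term, and the resulting \<open>B = 0\<close> is the first-order
  condition.\<close>

lemma nonneg_quadratic_discriminant: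
  fixes A B C :: real
  assumes "A \<ge> 0" and nonneg: "\<And>t. A * t\<^sup>2 + 2 * B * t + C \<ge> 0"
  shows "B\<^sup>2 \<le> A * C"
proof (cases "A = 0")
  case True
  have "B = 0"
  proof (rule ccontr)
    assume "B \<noteq> 0"
    then show False
      \<comment> \<open>At this \<open>t\<close> the remaining affine function takes the value
        -1.\<close>
      using nonneg[of "- (C + 1) / (2 * B)"] True by simp
  qed
  then show ?thesis
    using True by simp
next
  case False
  then have "A > 0"
    using assms by simp
  have "A * (- B / A)\<^sup>2 + 2 * B * (- B / A) + C = (A * C - B\<^sup>2) / A"
    using \<open>A > 0\<close> by (simp add: field_simps power2_eq_square)
  then show ?thesis
    using nonneg[of "- B / A"] \<open>A > 0\<close> by (simp add: zero_le_divide_iff)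
qed

text \<open>The hypothesis says \<open>-K \<le> P \<le> K\<close> for symmetric matrices with
  \<open>K\<close> diagonal, so the determinants of \<open>K + P\<close> and \<open>K - P\<close>
  are nonnegative (\<open>q1\<close>, \<open>q2\<close>). The conclusion compares Frobenius
  norms.\<close>

lemma psd_bound_2x2:
  fixes k l p q r :: real
  assumes bound: "\<And>y z. \<bar>p * y\<^sup>2 + 2 * q * y * z + r * z\<^sup>2\<bar> \<le> k * y\<^sup>2 + l * z\<^sup>2"
  shows "p\<^sup>2 + 2 * q\<^sup>2 + r\<^sup>2 \<le> k\<^sup>2 + l\<^sup>2"
proof -
  have p: "\<bar>p\<bar> \<le> k" and r: "\<bar>r\<bar> \<le> l"
    using bound[of 1 0] bound[of 0 1] by simp_all
  have q1: "q\<^sup>2 \<le> (k + p) * (l + r)"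
  proof (rule nonneg_quadratic_discriminant)
    show "0 \<le> (k + p) * t\<^sup>2 + 2 * q * t + (l + r)" for t
      using bound[of t 1] by (simp add: algebra_simps abs_le_iff)
  qed (use p in simp)
  have "(- q)\<^sup>2 \<le> (k - p) * (l - r)"
  proof (rule nonneg_quadratic_discriminant)
    show "0 \<le> (k - p) * t\<^sup>2 + 2 * (- q) * t + (l - r)" for t
      using bound[of t 1] by (simp add: algebra_simps abs_le_iff)
  qed (use p in simp)
  then have q2: "q\<^sup>2 \<le> (k - p) * (l - r)"
    by simp
  have nonneg: "0 \<le> k + p" "0 \<le> k - p" "0 \<le> l + r" "0 \<le> l - r"
    using p r by auto
  \<comment> \<open>The trace of the product of the positive semidefinite matrices \<open>K + P\<close> and \<open>K - P\<close> is nonnegative.\<close>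
  have "q\<^sup>2 * q\<^sup>2 \<le> ((k + p) * (l + r)) * ((k - p) * (l - r))"
    using q1 q2 nonneg by (intro mult_mono mult_nonneg_nonneg zero_le_power2)
  also have "\<dots> = ((k + p) * (k - p)) * ((l + r) * (l - r))"
    by simp
  finally have "4 * (q\<^sup>2)\<^sup>2 \<le> 4 * (((k + p) * (k - p)) * ((l + r) * (l - r)))"
    by (simp add: power2_eq_square)
  also have "\<dots> \<le> ((k + p) * (k - p) + (l + r) * (l - r))\<^sup>2"
    using arith_geo_mean_sqrt[of "(k + p) * (k - p)" "(l + r) * (l - r)"]
      zero_le_power2[of "(k + p) * (k - p) - (l + r) * (l - r)"]
    by (simp add: power2_eq_square algebra_simps)
  finally have "(2 * q\<^sup>2)\<^sup>2 \<le> ((k + p) * (k - p) + (l + r) * (l - r))\<^sup>2"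
    by (simp add: power_mult_distrib)
  moreover have "0 \<le> (k + p) * (k - p) + (l + r) * (l - r)"
    using nonneg by (intro add_nonneg_nonneg[OF mult_nonneg_nonneg mult_nonneg_nonneg])
  ultimately have "2 * q\<^sup>2 \<le> (k + p) * (k - p) + (l + r) * (l - r)"
    by (rule power2_le_imp_le)
  then show ?thesis
    by (simp add: algebra_simps power2_eq_square)
qed

text \<open>After division by \<open>\<kappa>\<close> the right side is smallest at
  \<open>\<kappa> = \<sigma> / \<xi>\<close>. For \<open>\<sigma> = 0\<close> the infimum is only
  approached as \<open>\<kappa>\<close> tends to 0, hence the limit argument.\<close>

lemma optimise_over_scale:
  fixes P h \<xi> \<sigma> :: real
  assumes "\<xi> > 0" "\<sigma> \<ge> 0" and bound: "\<And>\<kappa>. \<kappa> > 0 \<Longrightarrow> 4 * P * \<kappa> \<le> \<kappa>\<^sup>2 * \<xi>\<^sup>2 + 2 * h * \<kappa> + \<sigma>\<^sup>2"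
  shows "2 * P \<le> h + \<sigma> * \<xi>"
proof (cases "\<sigma> = 0")
  case False
  then have "\<sigma> / \<xi> > 0"
    using assms by simp
  from bound[OF this] have "4 * P * \<sigma> / \<xi> \<le> 2 * (h + \<sigma> * \<xi>) * \<sigma> / \<xi>"
    using assms by (simp add: field_simps power2_eq_square)
  then have "4 * P * (\<sigma> / \<xi>) \<le> 2 * (h + \<sigma> * \<xi>) * (\<sigma> / \<xi>)"
    by simp
  then show ?thesis
    using \<open>\<sigma> / \<xi> > 0\<close> by (subst (asm) mult_le_cancel_right) auto
next
  case True
  have "2 * P \<le> h + \<epsilon>" if "\<epsilon> > 0" for \<epsilon>
  proof -
    define \<kappa> where "\<kappa> = 2 * \<epsilon> / \<xi>\<^sup>2"
    have "\<kappa> > 0" "\<kappa> * \<xi>\<^sup>2 = 2 * \<epsilon>"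
      using assms that by (simp_all add: \<kappa>_def)
    from bound[OF this(1)] have "(4 * P) * \<kappa> \<le> (2 * \<epsilon> + 2 * h) * \<kappa>"
      using \<open>\<kappa> * \<xi>\<^sup>2 = 2 * \<epsilon>\<close> True by (simp add: power2_eq_square algebra_simps)
    then show ?thesis
      using \<open>\<kappa> > 0\<close> by (subst (asm) mult_le_cancel_right) auto
  qed
  then show ?thesis
    using True field_le_epsilon[of "2 * P" h] by simp
qed

section \<open>The polynomial inequality on the square\<close>

text \<open>With \<open>a = 1 + m\<close> this is \<open>1 - m - 2 * m\<^sup>2\<close>, the
  coefficient of \<open>t\<^sup>2 * y\<^sup>2\<close> left by the Schur complement.\<close>

definition gap :: "real \<Rightarrow> real" where
  "gap a = a * (3 - 2 * a)"

lemma gap_nonneg: "0 \<le> a \<Longrightarrow> a \<le> 3 / 2 \<Longrightarrow> 0 \<le> gap a"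
  by (simp add: gap_def)

lemma gap_le: "gap a \<le> 9 / 8"
  using zero_le_power2[of "a - 3 / 4"] by (simp add: gap_def power2_eq_square algebra_simps)

text \<open>The polynomial \<open>\<xi>\<close> approximates \<open>sqrt ((gap a)\<^sup>2 + (2 - b)\<^sup>2)\<close> from above and agrees with it at
  the values \<open>a = 0\<close> and \<open>a = 3/2\<close> that occur for the extremal form.\<close>

definition \<xi> :: "real \<Rightarrow> real \<Rightarrow> real" where
  "\<xi> a b = 2 - b + 9 / 8 * gap a * (1 / 4 + b / 2)"

text \<open>Since \<open>gap a \<le> 9 / 8\<close>, the square of \<open>gap a\<close> is at most
  linear in \<open>gap a\<close>. The cross term of the square of \<open>\<xi> a b\<close> covers it
  because \<open>(2 - b) * (1 / 2 + b) = 1 + b * (3 / 2 - b)\<close>.\<close>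

lemma \<xi>_square_ge:
  assumes "0 \<le> a" "a \<le> 3 / 2" "0 \<le> b" "b \<le> 3 / 2"
  shows "(gap a)\<^sup>2 + (2 - b)\<^sup>2 \<le> (\<xi> a b)\<^sup>2"
proof -
  have "(gap a)\<^sup>2 \<le> 9 / 8 * gap a"
    using mult_right_mono[OF gap_le[of a] gap_nonneg[of a]] assms by (simp add: power2_eq_square)
  also have "\<dots> \<le> 9 / 8 * gap a + 9 / 8 * gap a * (b * (3 / 2 - b))"
    using gap_nonneg[of a] assms by simp
  also have "\<dots> = 2 * (2 - b) * (9 / 8 * gap a * (1 / 4 + b / 2))"
    by (simp add: field_simps)
  also have "\<dots> \<le> (\<xi> a b)\<^sup>2 - (2 - b)\<^sup>2"
    using zero_le_power2[of "9 / 8 * gap a * (1 / 4 + b / 2)"]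
    unfolding \<xi>_def power2_sum by simp
  finally show ?thesis
    by simp
qed

lemma \<xi>_pos: "0 \<le> a \<Longrightarrow> a \<le> 3 / 2 \<Longrightarrow> 0 \<le> b \<Longrightarrow> b \<le> 3 / 2 \<Longrightarrow> 0 < \<xi> a b"
  unfolding \<xi>_def by (intro add_pos_nonneg mult_nonneg_nonneg gap_nonneg) auto

text \<open>\<open>?V\<close> is the slack in the sum of the two slice bounds. It is symmetric,
  hence a polynomial in \<open>S\<close> and \<open>P\<close>. It vanishes at the corners (0, 0),
  (3/2, 0) and (0, 3/2), so no constant can be given away there.\<close>

lemma gap_polynomial_nonneg:
  fixes a b :: real
  assumes a: "0 \<le> a" "a \<le> 3 / 2" and b: "0 \<le> b" "b \<le> 3 / 2"
  shows "0 \<le> gap a * (2 - a) + gap b * (2 - b) + 2 * a * b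
    - (a + b) * (9 / 32) * (gap a * (1 + 2 * b) + gap b * (1 + 2 * a))" (is "0 \<le> ?V")
proof -
  define S where "S = a + b"
  define P where "P = a * b"
  define \<alpha> where "\<alpha> = S * (3 - 2 * S) * (2 - 41 / 32 * S)"
  define \<beta> where "\<beta> = 16 - 21 / 2 * S + 9 / 8 * S\<^sup>2"
  have V: "?V = \<alpha> + \<beta> * P"
    unfolding \<alpha>_def \<beta>_def S_def P_def gap_def by (simp add: field_simps power2_eq_square)
  have "0 \<le> P" "0 \<le> S" "S \<le> 3"
    using a b by (auto simp: P_def S_def)
  show ?thesis
  proof (cases "S \<le> 3 / 2")
    case True
    \<comment> \<open>This is \<open>8 * \<beta>\<close> expanded about \<open>S = 3/2\<close>,
      without its positive constant term.\<close>
    have "0 \<le> (9 * (3/2 - S) + 57) * (3/2 - S)"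
      using True by (intro mult_nonneg_nonneg) auto
    then have "0 \<le> \<beta>"
      by (simp add: \<beta>_def field_simps power2_eq_square)
    moreover have "0 \<le> \<alpha>"
      unfolding \<alpha>_def using True \<open>0 \<le> S\<close> by (intro mult_nonneg_nonneg) auto
    ultimately show ?thesis
      using V \<open>0 \<le> P\<close> by simp
  next
    case False
    \<comment> \<open>For fixed \<open>S\<close> the bound is affine in \<open>P\<close>, so only the extreme values of \<open>P\<close> matter.\<close>
    define P0 where "P0 = 3 / 2 * (S - 3 / 2)"
    define P1 where "P1 = S\<^sup>2 / 4"
    \<comment> \<open>\<open>P0\<close> is the value of \<open>P\<close> on the edges
      \<open>a = 3/2\<close> and \<open>b = 3/2\<close>, \<open>P1\<close> the value on the diagonal
      \<open>a = b\<close>.\<close>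
    have P01: "P0 \<le> P" "P \<le> P1"
      using mult_nonneg_nonneg[of "3 / 2 - a" "3 / 2 - b"] a b zero_le_power2[of "a - b"]
      by (auto simp: P0_def P1_def P_def S_def power2_eq_square algebra_simps)
    have "\<alpha> + \<beta> * P0 = (S - 3/2) * (17/4 * (S - 3/2 - 14/17)\<^sup>2 + 287/272)"
      by (simp add: \<alpha>_def \<beta>_def P0_def field_simps power2_eq_square)
    then have 0: "0 \<le> \<alpha> + \<beta> * P0"
      using False by simp
    \<comment> \<open>The cubic factor has its local minimum near 11/5; dividing it by
      \<open>(S - 11/5)\<^sup>2\<close> leaves a linear remainder that is positive up to
      \<open>S = 3\<close>.\<close>
    have "0 \<le> S / 32 * (9 * (S - 11/5)\<^sup>2 * (S + 188/45) + (1252/125 - 28/25 * S))"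
      using \<open>0 \<le> S\<close> \<open>S \<le> 3\<close> by (intro mult_nonneg_nonneg add_nonneg_nonneg) auto
    also have "\<dots> = \<alpha> + \<beta> * P1"
      by (simp add: \<alpha>_def \<beta>_def P1_def field_simps power2_eq_square)
    finally have 1: "0 \<le> \<alpha> + \<beta> * P1" .
    show ?thesis
    proof (cases "\<beta> \<ge> 0")
      case True
      then show ?thesis
        using 0 V mult_left_mono[OF P01(1) True] by simp
    next
      case False
      then show ?thesis
        using 1 V mult_left_mono_neg[OF P01(2), of \<beta>] by linarith
    qed
  qed
qed

section \<open>Norm bounds from one-parameter slices\<close>

text \<open>The hypothesis is the polar bound for
  \<open>(t\<^sup>2 - 1) *\<^sub>R u + (2 * t) *\<^sub>R v\<close>, which has norm
  \<open>t\<^sup>2 + 1\<close>: a rational parametrisation of directions in the plane of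
  \<open>u, v\<close>. Eliminating \<open>x\<close> leaves a form in \<open>y, z\<close>; the two
  signs of \<open>t\<close> give the absolute value.\<close>

lemma quadratic_slice:
  fixes m n p q r :: real
  assumes bound: "\<And>t x y z. (t\<^sup>2 - 1) * (x\<^sup>2 + m * y\<^sup>2 + n * z\<^sup>2)
      + 2 * t * (2 * m * x * y + p * y\<^sup>2 + 2 * q * y * z + r * z\<^sup>2) \<le> (t\<^sup>2 + 1) * (x\<^sup>2 + y\<^sup>2 + z\<^sup>2)"
  defines "a \<equiv> 1 + m" and "b \<equiv> 1 + n"
  shows "\<bar>(2 * t * p) * y\<^sup>2 + 2 * (2 * t * q) * y * z + (2 * t * r) * z\<^sup>2\<bar>
    \<le> (t\<^sup>2 * gap a + a) * y\<^sup>2 + (t\<^sup>2 * (2 - b) + b) * z\<^sup>2"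
proof -
  \<comment> \<open>The choice \<open>x = t m y\<close> minimises the difference of both sides of the hypothesis.\<close>
  have "(2 * t * p) * y\<^sup>2 + 2 * (2 * t * q) * y * z + (2 * t * r) * z\<^sup>2
      \<le> (t\<^sup>2 * gap a + a) * y\<^sup>2 + (t\<^sup>2 * (2 - b) + b) * z\<^sup>2" for t
    using bound[of t "t * m * y" y z]
    by (simp add: a_def b_def gap_def power2_eq_square algebra_simps)
  from this[of t] this[of "- t"] show ?thesis
    by (simp add: abs_le_iff)
qed

text \<open>The coefficient of \<open>y\<^sup>2\<close> must be nonnegative: \<open>t = 0\<close>
  gives the lower bound, and for \<open>a > 3 / 2\<close>, where \<open>gap a\<close> is negative, a
  suitable \<open>t\<close> would make it \<open>- a\<close>.\<close>

lemma slice_range: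
  fixes m n p q r :: real
  assumes bound: "\<And>t x y z. (t\<^sup>2 - 1) * (x\<^sup>2 + m * y\<^sup>2 + n * z\<^sup>2)
      + 2 * t * (2 * m * x * y + p * y\<^sup>2 + 2 * q * y * z + r * z\<^sup>2) \<le> (t\<^sup>2 + 1) * (x\<^sup>2 + y\<^sup>2 + z\<^sup>2)"
  shows "0 \<le> 1 + m" "1 + m \<le> 3 / 2"
proof -
  define a where "a = 1 + m"
  have K: "0 \<le> t\<^sup>2 * gap a + a" for t
    using quadratic_slice[OF bound, of t 1 0] by (simp add: a_def)
  show "0 \<le> 1 + m"
    using K[of 0] by (simp add: a_def)
  show "1 + m \<le> 3 / 2"
  proof (rule ccontr)
    assume "\<not> 1 + m \<le> 3 / 2"
    then have "a > 3 / 2"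
      by (simp add: a_def)
    then have "(sqrt (2 / (2 * a - 3)))\<^sup>2 * gap a + a = - a"
      by (simp add: gap_def field_simps)
    then show False
      using K[of "sqrt (2 / (2 * a - 3))"] \<open>a > 3 / 2\<close> by simp
  qed
qed

text \<open>The Frobenius comparison holds for every \<open>\<kappa> = t\<^sup>2\<close>. Enlarging
  its leading and constant coefficients to the squares of \<open>\<xi> a b\<close> and
  \<open>a + b\<close> keeps the optimised bound polynomial.\<close>

lemma slice_bound:
  fixes m n p q r :: real
  assumes bound: "\<And>t x y z. (t\<^sup>2 - 1) * (x\<^sup>2 + m * y\<^sup>2 + n * z\<^sup>2)
      + 2 * t * (2 * m * x * y + p * y\<^sup>2 + 2 * q * y * z + r * z\<^sup>2) \<le> (t\<^sup>2 + 1) * (x\<^sup>2 + y\<^sup>2 + z\<^sup>2)"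
  defines "a \<equiv> 1 + m" and "b \<equiv> 1 + n"
  assumes b: "0 \<le> b" "b \<le> 3 / 2"
  shows "2 * (p\<^sup>2 + 2 * q\<^sup>2 + r\<^sup>2) \<le> (a * gap a + b * (2 - b)) + (a + b) * \<xi> a b"
proof (rule optimise_over_scale)
  have a: "0 \<le> a" "a \<le> 3 / 2"
    using slice_range[OF bound] by (auto simp: a_def)
  show "0 < \<xi> a b" "0 \<le> a + b"
    using a b \<xi>_pos by auto
  fix \<kappa> :: real assume "\<kappa> > 0"
  define t where "t = sqrt \<kappa>"
  have t: "t\<^sup>2 = \<kappa>"
    using \<open>\<kappa> > 0\<close> by (simp add: t_def)
  have "4 * (p\<^sup>2 + 2 * q\<^sup>2 + r\<^sup>2) * \<kappa> = (2 * t * p)\<^sup>2 + 2 * (2 * t * q)\<^sup>2 + (2 * t * r)\<^sup>2"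
    by (simp add: power_mult_distrib t algebra_simps)
  also have "\<dots> \<le> (t\<^sup>2 * gap a + a)\<^sup>2 + (t\<^sup>2 * (2 - b) + b)\<^sup>2"
    by (rule psd_bound_2x2) (use quadratic_slice[OF bound] in \<open>simp add: a_def b_def\<close>)
  also have "\<dots> = \<kappa>\<^sup>2 * ((gap a)\<^sup>2 + (2 - b)\<^sup>2) + 2 * (a * gap a + b * (2 - b)) * \<kappa> + (a\<^sup>2 + b\<^sup>2)"
    unfolding t by (simp add: power2_eq_square algebra_simps)
  also have "\<dots> \<le> \<kappa>\<^sup>2 * (\<xi> a b)\<^sup>2 + 2 * (a * gap a + b * (2 - b)) * \<kappa> + (a + b)\<^sup>2"
    using a b by (intro add_mono mult_left_mono \<xi>_square_ge order_refl)
      (auto simp: power2_sum)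
  finally show "4 * (p\<^sup>2 + 2 * q\<^sup>2 + r\<^sup>2) * \<kappa>
    \<le> \<kappa>\<^sup>2 * (\<xi> a b)\<^sup>2 + 2 * (a * gap a + b * (2 - b)) * \<kappa> + (a + b)\<^sup>2" .
qed

text \<open>The left side is the squared norm of \<open>T\<close> in the adapted frame. Exchanging
  \<open>v\<close> and \<open>w\<close> exchanges \<open>q\<close> and \<open>r\<close>, so adding
  the two slice bounds produces the weights 1, 3, 3, 1.\<close>

lemma two_slices_bound:
  fixes m n p q r s :: real
  assumes bound: "\<And>t x y z. (t\<^sup>2 - 1) * (x\<^sup>2 + m * y\<^sup>2 + n * z\<^sup>2)
      + 2 * t * (2 * m * x * y + p * y\<^sup>2 + 2 * q * y * z + r * z\<^sup>2) \<le> (t\<^sup>2 + 1) * (x\<^sup>2 + y\<^sup>2 + z\<^sup>2)"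
    and bound': "\<And>t x y z. (t\<^sup>2 - 1) * (x\<^sup>2 + n * y\<^sup>2 + m * z\<^sup>2)
      + 2 * t * (2 * n * x * y + s * y\<^sup>2 + 2 * r * y * z + q * z\<^sup>2) \<le> (t\<^sup>2 + 1) * (x\<^sup>2 + y\<^sup>2 + z\<^sup>2)"
  shows "1 + 3 * m\<^sup>2 + 3 * n\<^sup>2 + p\<^sup>2 + 3 * q\<^sup>2 + 3 * r\<^sup>2 + s\<^sup>2 \<le> 7"
proof -
  define a b where "a = 1 + m" and "b = 1 + n"
  have a: "0 \<le> a" "a \<le> 3 / 2" and b: "0 \<le> b" "b \<le> 3 / 2"
    using slice_range[OF bound] slice_range[OF bound'] by (auto simp: a_def b_def)
  have 1: "2 * (p\<^sup>2 + 2 * q\<^sup>2 + r\<^sup>2) \<le> (a * gap a + b * (2 - b)) + (a + b) * \<xi> a b"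
    unfolding a_def b_def by (rule slice_bound[OF bound]) (use b in \<open>simp_all add: b_def\<close>)
  have 2: "2 * (s\<^sup>2 + 2 * r\<^sup>2 + q\<^sup>2) \<le> (b * gap b + a * (2 - a)) + (b + a) * \<xi> b a"
    unfolding a_def b_def by (rule slice_bound[OF bound']) (use a in \<open>simp_all add: a_def\<close>)
  note add_mono[OF 1 2]
  also have "(a * gap a + b * (2 - b)) + (a + b) * \<xi> a b + ((b * gap b + a * (2 - a)) + (b + a) * \<xi> b a)
    = 12 - 6 * m\<^sup>2 - 6 * n\<^sup>2 - (gap a * (2 - a) + gap b * (2 - b) + 2 * a * b
    - (a + b) * (9 / 32) * (gap a * (1 + 2 * b) + gap b * (1 + 2 * a)))"
  proof -
    have m: "m = a - 1" and n: "n = b - 1"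
      by (simp_all add: a_def b_def)
    show ?thesis
      unfolding m n by (simp add: \<xi>_def gap_def power2_eq_square field_simps)
  qed
  also have "\<dots> \<le> 12 - 6 * m\<^sup>2 - 6 * n\<^sup>2 - 0"
    by (rule diff_left_mono[OF gap_polynomial_nonneg[OF a b]])
  finally show ?thesis
    by simp
qed

section \<open>Symmetric trilinear forms\<close>

text \<open>Parseval: \<open>g\<close> is the inner product with some \<open>v\<close>, and the
  matrix with rows \<open>e i\<close> preserves the norm of \<open>v\<close>.\<close>

lemma sum_squares_orthonormal:
  fixes e :: "'n::finite \<Rightarrow> real^'n" and g :: "real^'n \<Rightarrow> real"
  assumes orth: "\<And>i j. e i \<bullet> e j = (if i = j then 1 else 0)" and "linear g"
  shows "(\<Sum>i\<in>UNIV. (g (e i))\<^sup>2) = (\<Sum>i\<in>UNIV. (g (axis i 1))\<^sup>2)"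
proof -
  define A :: "real^'n^'n" where "A = (\<chi> i. e i)"
  define v where "v = adjoint g 1"
  have g: "g x = x \<bullet> v" for x
    using adjoint_works[OF \<open>linear g\<close>, of x 1] by (simp add: v_def)
  have "orthogonal_matrix A"
    unfolding orthogonal_matrix_orthonormal_rows A_def
    by (auto simp: row_def orth norm_eq_1 orthogonal_def)
  then have "norm (A *v v) = norm v"
    by (metis orthogonal_transformation_matrix orthogonal_transformation_norm
        matrix_of_matrix_vector_mul matrix_vector_mul_linear)
  then have "(A *v v) \<bullet> (A *v v) = v \<bullet> v"
    by (simp add: norm_eq)
  moreover have "(A *v v) $ i = g (e i)" for i
    by (simp add: A_def g matrix_vector_mult_def inner_vec_def)
  moreover have "v $ i = g (axis i 1)" for i
    by (simp add: g inner_axis' )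
  ultimately show ?thesis
    by (simp add: inner_vec_def power2_eq_square)
qed

locale sym_trilinear =
  fixes T :: "'a::euclidean_space \<Rightarrow> 'a \<Rightarrow> 'a \<Rightarrow> real"
  assumes linear3: "linear (T x y)"
    and swap12: "T x y z = T y x z"
    and swap23: "T x y z = T x z y"
begin

lemma linear2: "linear (\<lambda>y. T x y z)"
  using linear3[of x z] by (simp add: swap23[of x _ z])

lemma linear1: "linear (\<lambda>x. T x y z)"
  using linear2[of y z] by (simp add: swap12[of _ y z])

lemma add [simp]:
  "T (x + x') y z = T x y z + T x' y z"
  "T x (y + y') z = T x y z + T x y' z"
  "T x y (z + z') = T x y z + T x y z'"
  using linear_add[OF linear1] linear_add[OF linear2] linear_add[OF linear3] by blast+

lemma scale [simp]:
  "T (r *\<^sub>R x) y z = r * T x y z"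
  "T x (r *\<^sub>R y) z = r * T x y z"
  "T x y (r *\<^sub>R z) = r * T x y z"
  using linear_cmul[OF linear1] linear_cmul[OF linear2] linear_cmul[OF linear3] by simp_all

lemma minus [simp]: "T (- x) y z = - T x y z" "T x (- y) z = - T x y z" "T x y (- z) = - T x y z"
  using scale(1)[of "-1" x y z] scale(2)[of x "-1" y z] scale(3)[of x y "-1" z] by simp_all

text \<open>Exhibits \<open>T\<close> as a polynomial in coordinates, from which continuity and then
  the existence of maximisers follow.\<close>

lemma basis_expansion:
  "T x y z = (\<Sum>i\<in>Basis. \<Sum>j\<in>Basis. \<Sum>k\<in>Basis. (x \<bullet> i) * (y \<bullet> j) * (z \<bullet> k) * T i j k)"
proof -
  have 1: "T x y z = (\<Sum>i\<in>Basis. (x \<bullet> i) * T i y z)" for x y z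
    using linear_sum[OF linear1, of "\<lambda>i. (x \<bullet> i) *\<^sub>R i" Basis y z]
    by (simp add: euclidean_representation)
  have 2: "T x y z = (\<Sum>j\<in>Basis. (y \<bullet> j) * T x j z)" for x y z
    using linear_sum[OF linear2, of x "\<lambda>i. (y \<bullet> i) *\<^sub>R i" Basis z]
    by (simp add: euclidean_representation)
  have 3: "T x y z = (\<Sum>k\<in>Basis. (z \<bullet> k) * T x y k)" for x y z
    using linear_sum[OF linear3, of x y "\<lambda>i. (z \<bullet> i) *\<^sub>R i" Basis]
    by (simp add: euclidean_representation)
  have "T x y z = (\<Sum>i\<in>Basis. (x \<bullet> i) * (\<Sum>j\<in>Basis. (y \<bullet> j) * (\<Sum>k\<in>Basis. (z \<bullet> k) * T i j k)))"
    unfolding 1[of x y z] unfolding 2[of _ y z] unfolding 3[of _ _ z] by (rule refl)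
  then show ?thesis
    by (simp only: sum_distrib_left mult.assoc)
qed

lemma continuous_on_T [continuous_intros]:
  assumes "continuous_on S f" "continuous_on S g" "continuous_on S h"
  shows "continuous_on S (\<lambda>w. T (f w) (g w) (h w))"
proof -
  have "(\<lambda>w. T (f w) (g w) (h w)) = (\<lambda>w. \<Sum>i\<in>Basis. \<Sum>j\<in>Basis. \<Sum>k\<in>Basis.
      (f w \<bullet> i) * (g w \<bullet> j) * (h w \<bullet> k) * T i j k)"
    by (rule ext) (rule basis_expansion)
  then show ?thesis
    by (simp only:) (intro continuous_intros assms)
qed

text \<open>Banach's theorem. Among the maximisers \<open>(x, y)\<close> of \<open>T x y y\<close> on unit vectors, one with
  \<open>x \<bullet> y\<close> maximal must have \<open>x = y\<close>: otherwise \<open>y\<close> and the normalised \<open>x + y\<close> form a maximiser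
  with smaller angle.\<close>

lemma polar_bound:
  assumes bound: "\<And>x. T x x x \<le> norm x ^ 3"
  shows "T x y y \<le> norm x * (norm y)\<^sup>2"
proof -
  define S where "S = sphere (0::'a) 1 \<times> sphere (0::'a) 1"
  define F where "F w = T (fst w) (snd w) (snd w)" for w
  have "compact S" "S \<noteq> {}"
    by (auto simp: S_def compact_Times)
  have contF: "continuous_on S F"
    unfolding F_def by (intro continuous_intros)
  obtain w0 where "w0 \<in> S" and w0: "\<And>w. w \<in> S \<Longrightarrow> F w \<le> F w0"
    using continuous_attains_sup[OF \<open>compact S\<close> \<open>S \<noteq> {}\<close> contF] by blast
  define L where "L = F w0"
  have max_unit: "T x y y \<le> L" if "norm x = 1" "norm y = 1" for x y
    using w0[of "(x, y)"] that by (simp add: S_def F_def L_def)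
  have max: "T x y y \<le> L * (norm x * (norm y)\<^sup>2)" for x y
  proof (cases "x = 0 \<or> y = 0")
    case True
    then show ?thesis
      using scale(1)[of 0 x y y] scale(2)[of x 0 y y] by auto
  next
    case False
    have "T (x /\<^sub>R norm x) (y /\<^sub>R norm y) (y /\<^sub>R norm y) \<le> L"
      using False by (intro max_unit) auto
    then show ?thesis
      using False by (simp add: field_simps power2_eq_square)
  qed
  define K where "K = {w \<in> S. F w = L}"
  have "K = S \<inter> F -` {L}"
    by (auto simp: K_def)
  then have "compact K"
    by (metis \<open>compact S\<close> closed_singleton compact_Int_closed compact_imp_closed
        continuous_closed_preimage contF inf.left_idem)
  moreover have "w0 \<in> K"
    using \<open>w0 \<in> S\<close> by (simp add: K_def L_def)
  moreover have "continuous_on K (\<lambda>w. fst w \<bullet> snd w)"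
    by (intro continuous_intros)
  ultimately obtain w1 where "w1 \<in> K"
    and w1: "\<And>w. w \<in> K \<Longrightarrow> fst w \<bullet> snd w \<le> fst w1 \<bullet> snd w1"
    using continuous_attains_sup[of K "\<lambda>w. fst w \<bullet> snd w"] by blast
  obtain x y where "w1 = (x, y)"
    by fastforce
  define \<tau> where "\<tau> = x \<bullet> y"
  have nx: "norm x = 1" and ny: "norm y = 1" and L: "T x y y = L"
    using \<open>w1 \<in> K\<close> \<open>w1 = (x, y)\<close> by (auto simp: K_def S_def F_def)
  have closest: "u \<bullet> v \<le> \<tau>" if "norm u = 1" "norm v = 1" "T u v v = L" for u v
    using w1[of "(u, v)"] that \<open>w1 = (x, y)\<close> by (auto simp: K_def S_def F_def \<tau>_def)
  \<comment> \<open>Replacing \<open>y\<close> by \<open>- y\<close> leaves \<open>T x y y\<close>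
    unchanged.\<close>
  have "\<tau> \<ge> 0"
    using closest[of x "- y"] nx ny L by (simp add: \<tau>_def)
  have "\<tau> \<le> 1"
    using norm_cauchy_schwarz[of x y] nx ny by (simp add: \<tau>_def)
  have xx: "x \<bullet> x = 1" and yy: "y \<bullet> y = 1"
    using nx ny by (simp_all add: norm_eq_1)
  have "L \<ge> 0"
    using max_unit[of "- x" y] nx ny L by simp
  have "L \<le> 1"
  proof (cases "L = 0")
    case False
    then have "L > 0"
      using \<open>L \<ge> 0\<close> by simp
    have abs: "(T v y y)\<^sup>2 \<le> L\<^sup>2 * (v \<bullet> v)" for v
    proof -
      have "\<bar>T v y y\<bar> \<le> L * norm v"
        using max[of v y] max[of "- v" y] ny by auto
      then have "\<bar>T v y y\<bar>\<^sup>2 \<le> (L * norm v)\<^sup>2"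
        by (intro power_mono) auto
      then show ?thesis
        by (simp add: power_mult_distrib power2_norm_eq_inner)
    qed
    \<comment> \<open>First-order condition at \<open>v = x\<close>, in direction \<open>y\<close>,
      for \<open>L\<^sup>2 * (v \<bullet> v) - (T v y y)\<^sup>2\<close>, which is nonnegative and
      vanishes at \<open>x\<close>.\<close>
    have "(L\<^sup>2 * \<tau> - L * T y y y)\<^sup>2 \<le> (L\<^sup>2 - (T y y y)\<^sup>2) * 0"
    proof (rule nonneg_quadratic_discriminant)
      show "0 \<le> L\<^sup>2 - (T y y y)\<^sup>2"
        using abs[of y] yy by simp
      show "0 \<le> (L\<^sup>2 - (T y y y)\<^sup>2) * t\<^sup>2 + 2 * (L\<^sup>2 * \<tau> - L * T y y y) * t + 0" for t
        using abs[of "x + t *\<^sub>R y"] xx yy L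
        by (simp add: inner_add inner_commute[of y x] \<tau>_def[symmetric] algebra_simps power2_eq_square)
    qed
    then have "L\<^sup>2 * \<tau> - L * T y y y = 0"
      by simp
    then have "L * (L * \<tau> - T y y y) = 0"
      by (simp add: algebra_simps power2_eq_square)
    then have yyy: "T y y y = L * \<tau>"
      using \<open>L > 0\<close> by simp
    \<comment> \<open>The same argument in the quadratic slot: vary \<open>y\<close> in direction
      \<open>x\<close>.\<close>
    have "(L * \<tau> - T x y x)\<^sup>2 \<le> (L - T x x x) * 0"
    proof (rule nonneg_quadratic_discriminant)
      show "0 \<le> L - T x x x"
        using max[of x x] nx by simp
      show "0 \<le> (L - T x x x) * t\<^sup>2 + 2 * (L * \<tau> - T x y x) * t + 0" for t
      proof -
        have "T x (y + t *\<^sub>R x) (y + t *\<^sub>R x) = L + 2 * t * T x y x + t\<^sup>2 * T x x x"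
          using swap23[of x x y] by (simp add: L power2_eq_square algebra_simps)
        moreover have "(norm (y + t *\<^sub>R x))\<^sup>2 = 1 + 2 * t * \<tau> + t\<^sup>2"
          unfolding power2_norm_eq_inner
          by (simp add: inner_add inner_commute[of y x] xx yy \<tau>_def power2_eq_square algebra_simps)
        ultimately show ?thesis
          using max[of x "y + t *\<^sub>R x"] nx by (simp add: algebra_simps)
      qed
    qed
    then have xyx: "T x y x = L * \<tau>"
      by simp
    define w where "w = x + y"
    have ww: "(norm w)\<^sup>2 = 2 + 2 * \<tau>"
      by (simp add: power2_norm_eq_inner w_def inner_add inner_commute[of y x] xx yy \<tau>_def)
    have "norm w \<noteq> 0"
      using ww \<open>\<tau> \<ge> 0\<close> by auto
    then have "norm w > 0"
      by simp
    \<comment> \<open>Expands to \<open>T y x x + 2 * T y x y + T y y y\<close>, that is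
      \<open>L * \<tau> + 2 * L + L * \<tau>\<close>.\<close>
    have "T y w w = L * (norm w)\<^sup>2"
      using L xyx yyy swap12[of y x x] swap12[of y x y] swap23[of x x y] swap23[of y y x]
      unfolding ww by (simp add: w_def algebra_simps)
    then have "T y (w /\<^sub>R norm w) (w /\<^sub>R norm w) = L"
      using \<open>norm w > 0\<close> by (simp add: field_simps power2_eq_square)
    then have "y \<bullet> (w /\<^sub>R norm w) \<le> \<tau>"
      using \<open>norm w > 0\<close> ny by (intro closest) auto
    \<comment> \<open>Squared, this yields \<open>1 + \<tau> \<le> 2 * \<tau>\<^sup>2\<close>, which
      on [0, 1] leaves only \<open>\<tau> = 1\<close>.\<close>
    then have "1 + \<tau> \<le> \<tau> * norm w"
      using \<open>norm w > 0\<close> by (simp add: w_def inner_add inner_commute[of y x] yy \<tau>_def field_simps)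
    then have "(1 + \<tau>)\<^sup>2 \<le> \<tau>\<^sup>2 * (2 + 2 * \<tau>)"
      using \<open>\<tau> \<ge> 0\<close> power_mono[of "1 + \<tau>" "\<tau> * norm w" 2] by (simp add: power_mult_distrib ww)
    then have "(1 + \<tau>) * ((1 + 2 * \<tau>) * (1 - \<tau>)) \<le> 0"
      by (simp add: algebra_simps power2_eq_square)
    then have "\<not> \<tau> < 1"
      using \<open>\<tau> \<ge> 0\<close> mult_pos_pos[of "1 + \<tau>" "(1 + 2 * \<tau>) * (1 - \<tau>)"]
        mult_pos_pos[of "1 + 2 * \<tau>" "1 - \<tau>"] by linarith
    then have "\<tau> = 1"
      using \<open>\<tau> \<le> 1\<close> by simp
    then show ?thesis
      using bound[of y] yyy ny by simp
  qed simp
  then have "L * (norm x * (norm y)\<^sup>2) \<le> norm x * (norm y)\<^sup>2" for x y :: 'a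
    by (intro mult_left_le_one_le \<open>L \<ge> 0\<close>) auto
  then show ?thesis
    by (rule order_trans[OF max])
qed

end

section \<open>The adapted orthonormal frame\<close>

lemma norm_orthonormal_combination:
  assumes "norm u = 1" "norm v = 1" "norm w = 1" "u \<bullet> v = 0" "u \<bullet> w = 0" "v \<bullet> w = 0"
  shows "(norm (x *\<^sub>R u + y *\<^sub>R v + z *\<^sub>R w))\<^sup>2 = x\<^sup>2 + y\<^sup>2 + z\<^sup>2"
  using assms unfolding power2_norm_eq_inner norm_eq_1
  by (simp add: inner_add inner_commute[of v u] inner_commute[of w u] inner_commute[of w v] power2_eq_square)

context sym_trilinear
begin

lemma permute:
  assumes "T x y z = d"
  shows "T x y z = d" "T x z y = d" "T y x z = d" "T y z x = d" "T z x y = d" "T z y x = d"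
  using assms swap12 swap23 by metis+

lemma slice_of_frame:
  assumes bound: "\<And>x. T x x x \<le> norm x ^ 3"
    and frame: "norm u = 1" "norm v = 1" "norm w = 1" "u \<bullet> v = 0" "u \<bullet> w = 0" "v \<bullet> w = 0"
    and T0: "T u u u = 1" "T u u v = 0" "T u u w = 0" "T u v w = 0"
  shows "(t\<^sup>2 - 1) * (x\<^sup>2 + T u v v * y\<^sup>2 + T u w w * z\<^sup>2)
      + 2 * t * (2 * T u v v * x * y + T v v v * y\<^sup>2 + 2 * T v v w * y * z + T v w w * z\<^sup>2)
    \<le> (t\<^sup>2 + 1) * (x\<^sup>2 + y\<^sup>2 + z\<^sup>2)" (is "?L \<le> ?R")
proof -
  define e where "e = (t\<^sup>2 - 1) *\<^sub>R u + (2 * t) *\<^sub>R v"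
  define f where "f = x *\<^sub>R u + y *\<^sub>R v + z *\<^sub>R w"
  have "(norm e)\<^sup>2 = (t\<^sup>2 + 1)\<^sup>2"
    using norm_orthonormal_combination[OF frame, of "t\<^sup>2 - 1" "2 * t" 0]
    by (simp add: e_def power2_eq_square algebra_simps)
  then have e: "norm e = t\<^sup>2 + 1"
    by (simp add: power2_eq_iff_nonneg)
  have "T (\<alpha> *\<^sub>R u + \<beta> *\<^sub>R v) f f = \<alpha> * (x\<^sup>2 + T u v v * y\<^sup>2 + T u w w * z\<^sup>2)
      + \<beta> * (2 * T u v v * x * y + T v v v * y\<^sup>2 + 2 * T v v w * y * z + T v w w * z\<^sup>2)" for \<alpha> \<beta>
  proof -
    define k1 k2 k3 k4 k5 where k: "k1 = T u v v" "k2 = T u w w" "k3 = T v v v" "k4 = T v v w" "k5 = T v w w"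
    note k' = k[symmetric]
    show ?thesis
      unfolding f_def k'
      by (simp add: permute[OF T0(2)] permute[OF T0(3)] permute[OF T0(4)] T0(1) permute[OF k'(1)]
        permute[OF k'(2)] k'(3) permute[OF k'(4)] permute[OF k'(5)])
        (simp add: power2_eq_square algebra_simps)
  qed
  then have "?L = T e f f"
    unfolding e_def by simp
  also have "\<dots> \<le> norm e * (norm f)\<^sup>2"
    by (rule polar_bound[OF bound])
  also have "\<dots> = ?R"
    by (simp add: e f_def norm_orthonormal_combination[OF frame])
  finally show ?thesis .
qed

text \<open>By the polar bound \<open>x \<bullet> x - (T x u u)\<^sup>2\<close> is nonnegative; it
  vanishes at \<open>x = u\<close>, so its derivative in direction \<open>v\<close> is zero.\<close>

lemma critical_point:
  assumes bound: "\<And>x. T x x x \<le> norm x ^ 3"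
    and "norm u = 1" "T u u u = 1" "norm v = 1" "u \<bullet> v = 0"
  shows "T u u v = 0"
proof -
  have abs: "(T x u u)\<^sup>2 \<le> x \<bullet> x" for x
  proof -
    have "\<bar>T x u u\<bar> \<le> norm x"
      using polar_bound[OF bound, of x u] polar_bound[OF bound, of "- x" u] assms by auto
    then have "\<bar>T x u u\<bar>\<^sup>2 \<le> (norm x)\<^sup>2"
      by (intro power_mono) auto
    then show ?thesis
      by (simp add: power2_norm_eq_inner)
  qed
  have "(- T v u u)\<^sup>2 \<le> (1 - (T v u u)\<^sup>2) * 0"
  proof (rule nonneg_quadratic_discriminant)
    show "0 \<le> 1 - (T v u u)\<^sup>2"
      using abs[of v] assms by (simp add: norm_eq_1)
    show "0 \<le> (1 - (T v u u)\<^sup>2) * t\<^sup>2 + 2 * (- T v u u) * t + 0" for t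
      using abs[of "u + t *\<^sub>R v"] assms
      by (simp add: norm_eq_1 inner_add inner_commute[of v u] power2_eq_square algebra_simps)
  qed
  then show ?thesis
    using permute[of v u u] by simp
qed

end

text \<open>One slot is changed at a time by Parseval, after rotating the sums so that its index is
  innermost.\<close>

lemma sum_squares_trilinear_orthonormal:
  fixes e :: "'n::finite \<Rightarrow> real^'n"
  assumes "sym_trilinear T" and orth: "\<And>i j. e i \<bullet> e j = (if i = j then 1 else 0)"
  shows "(\<Sum>i\<in>UNIV. \<Sum>j\<in>UNIV. \<Sum>k\<in>UNIV. (T (e i) (e j) (e k))\<^sup>2)
    = (\<Sum>i\<in>UNIV. \<Sum>j\<in>UNIV. \<Sum>k\<in>UNIV. (T (axis i 1) (axis j 1) (axis k 1))\<^sup>2)"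
proof -
  interpret sym_trilinear T
    by fact
  let ?a = "\<lambda>i. axis i (1::real) :: real^'n"
  have rotate: "(\<Sum>i\<in>UNIV. \<Sum>j\<in>UNIV. \<Sum>k\<in>UNIV. f i j k) = (\<Sum>j\<in>UNIV. \<Sum>k\<in>UNIV. \<Sum>i\<in>UNIV. f i j k)"
    for f :: "'n \<Rightarrow> 'n \<Rightarrow> 'n \<Rightarrow> real"
    by (subst sum.swap) (intro sum.cong refl sum.swap)
  have "(\<Sum>i\<in>UNIV. \<Sum>j\<in>UNIV. \<Sum>k\<in>UNIV. (T (e i) (e j) (e k))\<^sup>2)
      = (\<Sum>i\<in>UNIV. \<Sum>j\<in>UNIV. \<Sum>k\<in>UNIV. (T (e i) (e j) (?a k))\<^sup>2)"
    by (intro sum.cong refl sum_squares_orthonormal orth linear3)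
  also have "\<dots> = (\<Sum>j\<in>UNIV. \<Sum>k\<in>UNIV. \<Sum>i\<in>UNIV. (T (e i) (e j) (?a k))\<^sup>2)"
    by (rule rotate)
  also have "\<dots> = (\<Sum>j\<in>UNIV. \<Sum>k\<in>UNIV. \<Sum>i\<in>UNIV. (T (?a i) (e j) (?a k))\<^sup>2)"
    by (intro sum.cong refl sum_squares_orthonormal orth linear1)
  also have "\<dots> = (\<Sum>k\<in>UNIV. \<Sum>i\<in>UNIV. \<Sum>j\<in>UNIV. (T (?a i) (e j) (?a k))\<^sup>2)"
    by (rule rotate)
  also have "\<dots> = (\<Sum>k\<in>UNIV. \<Sum>i\<in>UNIV. \<Sum>j\<in>UNIV. (T (?a i) (?a j) (?a k))\<^sup>2)"
    by (intro sum.cong refl sum_squares_orthonormal[where g = "\<lambda>y. T _ y _"] orth linear2)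
  also have "\<dots> = (\<Sum>i\<in>UNIV. \<Sum>j\<in>UNIV. \<Sum>k\<in>UNIV. (T (?a i) (?a j) (?a k))\<^sup>2)"
    by (rule rotate)
  finally show ?thesis .
qed

lemma sum_squares_bound:
  fixes T :: "real^3 \<Rightarrow> real^3 \<Rightarrow> real^3 \<Rightarrow> real"
  assumes "sym_trilinear T"
    and bound: "\<And>x. T x x x \<le> norm x ^ 3"
    and u: "norm u = 1" "T u u u = 1"
  shows "(\<Sum>i\<in>UNIV. \<Sum>j\<in>UNIV. \<Sum>k\<in>UNIV. (T (axis i 1) (axis j 1) (axis k 1))\<^sup>2) \<le> 7"
proof -
  interpret sym_trilinear T
    by fact
  \<comment> \<open>Maximising \<open>T u v v\<close> over unit vectors orthogonal to
    \<open>u\<close> diagonalises \<open>T u\<close> there: the first-order condition at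
    \<open>v\<close> is \<open>T u v w = 0\<close>.\<close>
  define S where "S = sphere 0 1 \<inter> {v. u \<bullet> v = 0}"
  have "compact S"
    unfolding S_def by (intro compact_Int_closed compact_sphere closed_hyperplane)
  obtain v0 :: "real^3" where v0: "v0 \<noteq> 0" "u \<bullet> v0 = 0"
    using orthogonal_to_vector_exists[of u] by (auto simp: orthogonal_def)
  then have "v0 /\<^sub>R norm v0 \<in> S"
    by (simp add: S_def)
  then have "S \<noteq> {}"
    by blast
  have "continuous_on S (\<lambda>v. T u v v)"
    by (intro continuous_intros)
  from continuous_attains_sup[OF \<open>compact S\<close> \<open>S \<noteq> {}\<close> this]
  obtain v where "v \<in> S" and v_max: "\<And>z. z \<in> S \<Longrightarrow> T u z z \<le> T u v v"
    by blast
  have v: "norm v = 1" "u \<bullet> v = 0"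
    using \<open>v \<in> S\<close> by (auto simp: S_def)
  define w where "w = cross3 u v"
  have uw: "u \<bullet> w = 0" and vw: "v \<bullet> w = 0"
    by (simp_all add: w_def dot_cross_self)
  have "(norm w)\<^sup>2 = 1"
    using norm_cross[of u v] u v by (simp add: w_def)
  then have w: "norm w = 1"
    by (simp add: norm_eq_1 power2_norm_eq_inner)
  have form_max: "T u z z \<le> T u v v * (norm z)\<^sup>2" if "u \<bullet> z = 0" for z
  proof (cases "z = 0")
    case True
    then show ?thesis
      using scale(3)[of u 0 0 0] by simp
  next
    case False
    then have "z /\<^sub>R norm z \<in> S"
      using that by (simp add: S_def)
    from v_max[OF this] show ?thesis
      using False by (simp add: field_simps power2_eq_square)
  qed
  have "(- T u v w)\<^sup>2 \<le> (T u v v - T u w w) * 0"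
  proof (rule nonneg_quadratic_discriminant)
    show "0 \<le> T u v v - T u w w"
      using form_max[OF uw] w by simp
    show "0 \<le> (T u v v - T u w w) * t\<^sup>2 + 2 * (- T u v w) * t + 0" for t
    proof -
      have "(norm (v + t *\<^sub>R w))\<^sup>2 = 1 + t\<^sup>2"
        using norm_orthonormal_combination[OF u(1) v(1) w v(2) uw vw, of 0 1 t] by simp
      moreover have "T u (v + t *\<^sub>R w) (v + t *\<^sub>R w) = T u v v + 2 * t * T u v w + t\<^sup>2 * T u w w"
        using swap23[of u w v] by (simp add: power2_eq_square algebra_simps)
      moreover have "u \<bullet> (v + t *\<^sub>R w) = 0"
        using v uw by (simp add: inner_add)
      ultimately show ?thesis
        using form_max[of "v + t *\<^sub>R w"] by (simp add: algebra_simps)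
    qed
  qed
  then have uvw: "T u v w = 0"
    by simp
  have uuv: "T u u v = 0" and uuw: "T u u w = 0"
    using critical_point[OF bound u] v w uw by auto
  have frame_bound: "1 + 3 * (T u v v)\<^sup>2 + 3 * (T u w w)\<^sup>2 + (T v v v)\<^sup>2 + 3 * (T v v w)\<^sup>2
      + 3 * (T v w w)\<^sup>2 + (T w w w)\<^sup>2 \<le> 7"
  proof (rule two_slices_bound)
    show "(t\<^sup>2 - 1) * (x\<^sup>2 + T u v v * y\<^sup>2 + T u w w * z\<^sup>2)
      + 2 * t * (2 * T u v v * x * y + T v v v * y\<^sup>2 + 2 * T v v w * y * z + T v w w * z\<^sup>2)
      \<le> (t\<^sup>2 + 1) * (x\<^sup>2 + y\<^sup>2 + z\<^sup>2)" for t x y z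
      by (rule slice_of_frame[OF bound u(1) v(1) w v(2) uw vw u(2) uuv uuw uvw])
    have "w \<bullet> v = 0" "T u w v = 0"
      using vw permute(2)[OF uvw] by (simp_all add: inner_commute)
    from slice_of_frame[OF bound u(1) w v(1) uw v(2) this(1) u(2) uuw uuv this(2)]
    show "(t\<^sup>2 - 1) * (x\<^sup>2 + T u w w * y\<^sup>2 + T u v v * z\<^sup>2)
      + 2 * t * (2 * T u w w * x * y + T w w w * y\<^sup>2 + 2 * T v w w * y * z + T v v w * z\<^sup>2)
      \<le> (t\<^sup>2 + 1) * (x\<^sup>2 + y\<^sup>2 + z\<^sup>2)" for t x y z
      using permute[OF refl[of "T v w w"]] permute[OF refl[of "T v v w"]] by simp
  qed
  define e :: "3 \<Rightarrow> real^3" where "e i = (if i = 1 then u else if i = 2 then v else w)" for i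
  have e: "e 1 = u" "e 2 = v" "e 3 = w"
    by (simp_all add: e_def)
  have "\<forall>i j. e i \<bullet> e j = (if i = j then 1 else 0)"
    using u(1) v w uw vw by (simp add: forall_3 e norm_eq_1 inner_commute)
  then have "(\<Sum>i\<in>UNIV. \<Sum>j\<in>UNIV. \<Sum>k\<in>UNIV. (T (axis i 1) (axis j 1) (axis k 1))\<^sup>2)
    = (\<Sum>i\<in>UNIV. \<Sum>j\<in>UNIV. \<Sum>k\<in>UNIV. (T (e i) (e j) (e k))\<^sup>2)"
    by (intro sum_squares_trilinear_orthonormal[symmetric] \<open>sym_trilinear T\<close>) simp
  also have "\<dots> = 1 + 3 * (T u v v)\<^sup>2 + 3 * (T u w w)\<^sup>2 + (T v v v)\<^sup>2 + 3 * (T v v w)\<^sup>2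
      + 3 * (T v w w)\<^sup>2 + (T w w w)\<^sup>2"
  proof -
    define k1 k2 k4 k5 where k: "k1 = T u v v" "k2 = T u w w" "k4 = T v v w" "k5 = T v w w"
    note k' = k[symmetric]
    show ?thesis
      unfolding k'
      by (simp add: sum_3 e permute[OF uuv] permute[OF uuw] permute[OF uvw] u(2) permute[OF k'(1)]
        permute[OF k'(2)] permute[OF k'(3)] permute[OF k'(4)])
  qed
  finally show ?thesis
    using frame_bound by simp
qed

section \<open>Ternary cubic forms\<close>

text \<open>The polarisation of \<open>eval3 c\<close>: each coefficient is divided by its
  multinomial number and spread over the index permutations.\<close>

definition cubic_polar :: "(nat \<times> nat \<times> nat \<Rightarrow> real) \<Rightarrow> real^3 \<Rightarrow> real^3 \<Rightarrow> real^3 \<Rightarrow> real" where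
  "cubic_polar c x y z =
     c (3, 0, 0) * (x$1 * y$1 * z$1) + c (0, 3, 0) * (x$2 * y$2 * z$2) + c (0, 0, 3) * (x$3 * y$3 * z$3)
   + c (2, 1, 0) / 3 * (x$1 * y$1 * z$2 + x$1 * y$2 * z$1 + x$2 * y$1 * z$1)
   + c (2, 0, 1) / 3 * (x$1 * y$1 * z$3 + x$1 * y$3 * z$1 + x$3 * y$1 * z$1)
   + c (1, 2, 0) / 3 * (x$2 * y$2 * z$1 + x$2 * y$1 * z$2 + x$1 * y$2 * z$2)
   + c (0, 2, 1) / 3 * (x$2 * y$2 * z$3 + x$2 * y$3 * z$2 + x$3 * y$2 * z$2)
   + c (1, 0, 2) / 3 * (x$3 * y$3 * z$1 + x$3 * y$1 * z$3 + x$1 * y$3 * z$3)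
   + c (0, 1, 2) / 3 * (x$3 * y$3 * z$2 + x$3 * y$2 * z$3 + x$2 * y$3 * z$3)
   + c (1, 1, 1) / 6 * (x$1 * y$2 * z$3 + x$1 * y$3 * z$2 + x$2 * y$1 * z$3
       + x$2 * y$3 * z$1 + x$3 * y$1 * z$2 + x$3 * y$2 * z$1)"

lemma idx3_eq:
  "idx3 = {(3, 0, 0), (0, 3, 0), (0, 0, 3), (2, 1, 0), (2, 0, 1), (1, 2, 0), (0, 2, 1), (1, 0, 2),
    (0, 1, 2), (1, 1, 1)}" (is "_ = ?S")
proof
  show "idx3 \<subseteq> ?S"
  proof
    fix \<alpha> assume "\<alpha> \<in> idx3"
    then obtain a b d where \<alpha>: "\<alpha> = (a, b, d)" "a + b + d = 3"
      by (auto simp: idx3_def)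
    then have "a \<in> {0, 1, 2, 3}" "b \<in> {0, 1, 2, 3}" "d = 3 - a - b"
      by auto
    then show "\<alpha> \<in> ?S"
      using \<alpha> by (elim insertE emptyE) simp_all
  qed
qed (auto simp: idx3_def)

lemma sum_idx3:
  fixes f :: "nat \<times> nat \<times> nat \<Rightarrow> real"
  shows "sum f idx3 = f (3, 0, 0) + f (0, 3, 0) + f (0, 0, 3) + f (2, 1, 0) + f (2, 0, 1) + f (1, 2, 0)
    + f (0, 2, 1) + f (1, 0, 2) + f (0, 1, 2) + f (1, 1, 1)"
  by (simp add: idx3_eq)

lemma eval3_eq_cubic_polar: "eval3 c x = cubic_polar c x x x"
  by (simp add: eval3_def sum_idx3 cubic_polar_def power2_eq_square power3_eq_cube algebra_simps)

lemma sym_trilinear_cubic_polar: "sym_trilinear (\<lambda>x y z. r * cubic_polar c x y z)"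
proof (rule sym_trilinear.intro)
  show "linear (\<lambda>z. r * cubic_polar c x y z)" for x y
    by (rule linearI) (simp_all add: cubic_polar_def algebra_simps)
  show "r * cubic_polar c x y z = r * cubic_polar c y x z" for x y z
    by (simp add: cubic_polar_def algebra_simps)
  show "r * cubic_polar c x y z = r * cubic_polar c x z y" for x y z
    by (simp add: cubic_polar_def algebra_simps)
qed

lemma bnorm_square:
  "(bnorm c)\<^sup>2 = (c (3, 0, 0))\<^sup>2 + (c (0, 3, 0))\<^sup>2 + (c (0, 0, 3))\<^sup>2
    + ((c (2, 1, 0))\<^sup>2 + (c (2, 0, 1))\<^sup>2 + (c (1, 2, 0))\<^sup>2 + (c (0, 2, 1))\<^sup>2 + (c (1, 0, 2))\<^sup>2
      + (c (0, 1, 2))\<^sup>2) / 3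
    + (c (1, 1, 1))\<^sup>2 / 6"
proof -
  have "(bnorm c)\<^sup>2 = (\<Sum>\<alpha>\<in>idx3. \<bar>c \<alpha>\<bar>\<^sup>2 / multinom3 \<alpha>)"
    unfolding bnorm_def by (intro real_sqrt_pow2 sum_nonneg) (auto simp: multinom3_def)
  then show ?thesis
    by (simp add: sum_idx3 multinom3_def fact_numeral add_divide_distrib)
qed

text \<open>The entry \<open>c \<alpha> / multinom3 \<alpha>\<close> occurs
  \<open>multinom3 \<alpha>\<close> times among the 27 index triples, so the Bombieri norm is the
  Frobenius norm of the polar form.\<close>

lemma bnorm_square_eq_sum_polar:
  "(bnorm c)\<^sup>2 = (\<Sum>i\<in>UNIV. \<Sum>j\<in>UNIV. \<Sum>k\<in>UNIV. (cubic_polar c (axis i 1) (axis j 1) (axis k 1))\<^sup>2)"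
  unfolding bnorm_square sum_3 cubic_polar_def by (simp add: axis_def power_divide)

lemma bnorm_pos:
  assumes "cubic_form c" "c \<noteq> (\<lambda>_. 0)"
  shows "0 < bnorm c"
proof -
  obtain \<alpha> where "c \<alpha> \<noteq> 0"
    using assms(2) by (meson ext)
  then have "\<alpha> \<in> idx3"
    using assms(1) unfolding cubic_form_def by blast
  have "0 < (\<Sum>\<alpha>\<in>idx3. \<bar>c \<alpha>\<bar>\<^sup>2 / multinom3 \<alpha>)"
  proof (rule sum_pos2[OF _ \<open>\<alpha> \<in> idx3\<close>])
    show "finite idx3"
      by (simp add: idx3_eq)
    show "0 < \<bar>c \<alpha>\<bar>\<^sup>2 / multinom3 \<alpha>"
      using \<open>c \<alpha> \<noteq> 0\<close> by (cases \<alpha>) (simp add: multinom3_def)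
    show "0 \<le> \<bar>c \<beta>\<bar>\<^sup>2 / multinom3 \<beta>" for \<beta>
      by (cases \<beta>) (simp add: multinom3_def)
  qed
  then show ?thesis
    by (simp add: bnorm_def)
qed

text \<open>Ten points suffice: the axes give the pure cubes, sums and differences of two axes
  separate the mixed pairs, and (1, 1, 1) gives the last coefficient.\<close>

lemma coefficients_from_values:
  assumes "\<And>x. cubic_polar c x x x = cubic_polar c' x x x" and "\<alpha> \<in> idx3"
  shows "c \<alpha> = c' \<alpha>"
proof -
  have eq: "cubic_polar c (vector [x, y, z]) (vector [x, y, z]) (vector [x, y, z])
    = cubic_polar c' (vector [x, y, z]) (vector [x, y, z]) (vector [x, y, z])" for x y z
    by (rule assms)
  note pts = eq[of 1 0 0] eq[of 0 1 0] eq[of 0 0 1] eq[of 1 1 0] eq[of 1 "-1" 0] eq[of 1 0 1]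
    eq[of 1 0 "-1"] eq[of 0 1 1] eq[of 0 1 "-1"] eq[of 1 1 1]
  have "c (3, 0, 0) = c' (3, 0, 0)" "c (0, 3, 0) = c' (0, 3, 0)" "c (0, 0, 3) = c' (0, 0, 3)"
    "c (2, 1, 0) = c' (2, 1, 0)" "c (2, 0, 1) = c' (2, 0, 1)" "c (1, 2, 0) = c' (1, 2, 0)"
    "c (0, 2, 1) = c' (0, 2, 1)" "c (1, 0, 2) = c' (1, 0, 2)" "c (0, 1, 2) = c' (0, 1, 2)"
    "c (1, 1, 1) = c' (1, 1, 1)"
    using pts by (simp_all add: cubic_polar_def)
  then show ?thesis
    using \<open>\<alpha> \<in> idx3\<close> by (auto simp: idx3_eq)
qed

lemma unorm_attained:
  obtains u where "norm u = 1" "eval3 c u = unorm c" "\<And>x. eval3 c x \<le> unorm c * norm x ^ 3"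
proof -
  interpret sym_trilinear "cubic_polar c"
    using sym_trilinear_cubic_polar[of 1 c] by simp
  let ?S = "sphere (0::real^3) 1"
  have cont: "continuous_on ?S (\<lambda>x. \<bar>eval3 c x\<bar>)"
    unfolding eval3_eq_cubic_polar by (intro continuous_intros)
  have "?S \<noteq> {}" "compact ?S"
    by auto
  then obtain u0 where u0: "u0 \<in> ?S" and max: "\<And>x. x \<in> ?S \<Longrightarrow> \<bar>eval3 c x\<bar> \<le> \<bar>eval3 c u0\<bar>"
    using continuous_attains_sup[OF _ _ cont] by blast
  have "unorm c = \<bar>eval3 c u0\<bar>"
    unfolding unorm_def using u0 max by (intro cSup_eq_maximum) auto
  \<comment> \<open>Odd degree lets a sign change of the point remove the absolute value.\<close>
  define u where "u = (if eval3 c u0 \<ge> 0 then u0 else - u0)"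
  show ?thesis
  proof
    show "norm u = 1"
      using u0 by (simp add: u_def)
    show "eval3 c u = unorm c"
      using \<open>unorm c = _\<close> by (simp add: u_def eval3_eq_cubic_polar)
    show "eval3 c x \<le> unorm c * norm x ^ 3" for x
    proof (cases "x = 0")
      case True
      then show ?thesis
        using scale(1)[of 0 x x x] by (simp add: eval3_eq_cubic_polar)
    next
      case False
      then have "x /\<^sub>R norm x \<in> ?S"
        by simp
      from max[OF this] have "\<bar>cubic_polar c x x x\<bar> / norm x ^ 3 \<le> unorm c"
        using \<open>unorm c = _\<close> by (simp add: eval3_eq_cubic_polar field_simps power3_eq_cube)
      then have "\<bar>cubic_polar c x x x\<bar> \<le> unorm c * norm x ^ 3"
        using False by (simp add: divide_le_eq)
      then show ?thesis
        by (simp add: eval3_eq_cubic_polar)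
    qed
  qed
qed

lemma bnorm_square_le:
  shows "(bnorm c)\<^sup>2 \<le> 7 * (unorm c)\<^sup>2" "0 \<le> unorm c"
proof -
  obtain u where u: "norm u = 1" "eval3 c u = unorm c" and bound: "\<And>x. eval3 c x \<le> unorm c * norm x ^ 3"
    using unorm_attained by blast
  interpret sym_trilinear "cubic_polar c"
    using sym_trilinear_cubic_polar[of 1 c] by simp
  show "0 \<le> unorm c"
    using bound[of "- u"] u by (simp add: eval3_eq_cubic_polar)
  show "(bnorm c)\<^sup>2 \<le> 7 * (unorm c)\<^sup>2"
  proof (cases "unorm c = 0")
    case True
    \<comment> \<open>Normalisation by \<open>unorm c\<close> is impossible here, but the form
      vanishes identically.\<close>
    have "cubic_polar c x x x = cubic_polar (\<lambda>_. 0) x x x" for x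
      using bound[of x] bound[of "- x"] True by (simp add: eval3_eq_cubic_polar) (simp add: cubic_polar_def)
    from coefficients_from_values[OF this] have "c \<alpha> = 0" if "\<alpha> \<in> idx3" for \<alpha>
      using that by simp
    then show ?thesis
      by (simp add: bnorm_def)
  next
    case False
    then have "unorm c > 0"
      using \<open>0 \<le> unorm c\<close> by simp
    define T where "T = (\<lambda>x y z. (1 / unorm c) * cubic_polar c x y z)"
    have "(\<Sum>i\<in>UNIV. \<Sum>j\<in>UNIV. \<Sum>k\<in>UNIV. (T (axis i 1) (axis j 1) (axis k 1))\<^sup>2) \<le> 7"
    proof (rule sum_squares_bound[OF _ _ u(1)])
      show "sym_trilinear T"
        unfolding T_def by (rule sym_trilinear_cubic_polar)
      show "T x x x \<le> norm x ^ 3" for x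
        using bound[of x] \<open>unorm c > 0\<close> by (simp add: T_def eval3_eq_cubic_polar field_simps)
      show "T u u u = 1"
        using u(2) \<open>unorm c > 0\<close> by (simp add: T_def eval3_eq_cubic_polar)
    qed
    moreover have "(\<Sum>i\<in>UNIV. \<Sum>j\<in>UNIV. \<Sum>k\<in>UNIV. (T (axis i 1) (axis j 1) (axis k 1))\<^sup>2)
      = (bnorm c)\<^sup>2 / (unorm c)\<^sup>2"
      unfolding bnorm_square_eq_sum_polar T_def
      by (simp add: power_divide sum_divide_distrib)
    ultimately show ?thesis
      using \<open>unorm c > 0\<close> by (simp add: divide_le_eq)
  qed
qed

section \<open>The equality case\<close>

text \<open>On the unit sphere this is the Chebyshev polynomial \<open>4 * t^3 - 3 * t\<close> in
  the first coordinate.\<close>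

lemma Ch33_eq: "Ch33 y = 4 * (y$1) ^ 3 - 3 * y$1 * (norm y)\<^sup>2"
  unfolding power2_norm_eq_inner
  by (simp add: Ch33_def inner_vec_def sum_3 power2_eq_square power3_eq_cube algebra_simps)

lemma abs_Ch33_le:
  assumes "norm y = 1"
  shows "\<bar>Ch33 y\<bar> \<le> 1"
proof -
  have "\<bar>y$1\<bar> \<le> 1"
    using component_le_norm_cart[of y 1] assms by simp
  then have y: "-1 \<le> y$1" "y$1 \<le> 1"
    by auto
  \<comment> \<open>The double roots are the interior extrema of the Chebyshev polynomial.\<close>
  have "1 - Ch33 y = (1 - y$1) * (2 * y$1 + 1)\<^sup>2" "1 + Ch33 y = (1 + y$1) * (2 * y$1 - 1)\<^sup>2"
    using assms by (simp_all add: Ch33_eq power2_eq_square power3_eq_cube algebra_simps)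
  moreover have "0 \<le> (1 - y$1) * (2 * y$1 + 1)\<^sup>2" "0 \<le> (1 + y$1) * (2 * y$1 - 1)\<^sup>2"
    using y by simp_all
  ultimately show ?thesis
    by linarith
qed

text \<open>\<open>Ch33\<close> is invariant under rotations about the first axis, so only the image
  of that axis under \<open>\<rho>\<close> matters.\<close>

lemma CO_act_Ch33:
  assumes "orthogonal_transformation \<rho>"
  shows "CO_act s \<rho> Ch33 x = s * (4 * (x \<bullet> \<rho> (axis 1 1)) ^ 3 - 3 * (x \<bullet> \<rho> (axis 1 1)) * (x \<bullet> x))"
proof -
  have "bij \<rho>"
    using assms by (rule orthogonal_transformation_bij)
  have inv: "orthogonal_transformation (inv \<rho>)"
    using assms by (rule orthogonal_transformation_inv)
  have "inv \<rho> x $ 1 = inv \<rho> x \<bullet> axis 1 1"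
    by (simp add: inner_axis)
  also have "\<dots> = \<rho> (inv \<rho> x) \<bullet> \<rho> (axis 1 1)"
    using assms by (simp add: orthogonal_transformation_def)
  also have "\<dots> = x \<bullet> \<rho> (axis 1 1)"
    using \<open>bij \<rho>\<close> by (simp add: bij_is_surj surj_f_inv_f)
  finally show ?thesis
    using orthogonal_transformation_norm[OF inv, of x]
    by (simp add: CO_act_def Ch33_eq power2_norm_eq_inner[symmetric])
qed

lemma bnorm_square_CO_act_Ch33:
  assumes "orthogonal_transformation \<rho>" and c: "eval3 c = CO_act s \<rho> Ch33"
  shows "(bnorm c)\<^sup>2 = 7 * s\<^sup>2"
proof -
  define u where "u = \<rho> (axis 1 1)"
  have "norm u = 1"
    using orthogonal_transformation_norm[OF assms(1)] by (simp add: u_def norm_axis_1)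
  then have "u \<bullet> u = 1"
    by (simp add: norm_eq_1)
  define a b d where "a = u$1" and "b = u$2" and "d = u$3"
  have abd: "a\<^sup>2 + b\<^sup>2 + d\<^sup>2 = 1"
    using \<open>u \<bullet> u = 1\<close> by (simp add: inner_vec_def sum_3 a_def b_def d_def power2_eq_square)
  \<comment> \<open>In \<open>(x \<bullet> u) * (x \<bullet> x)\<close> a monomial with exactly one
    odd exponent has the matching coordinate of \<open>u\<close> as coefficient;
    \<open>x$1 * x$2 * x$3\<close> does not occur.\<close>
  define c' where "c' = (\<lambda>(i, j, k). s * (4 * multinom3 (i, j, k) * a ^ i * b ^ j * d ^ k
    - 3 * (if odd i \<and> even j \<and> even k then a else if odd j \<and> even i \<and> even k then b
        else if odd k \<and> even i \<and> even j then d else 0)))"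
  have c'_eq: "c' (3, 0, 0) = s * (4 * a ^ 3 - 3 * a)" "c' (0, 3, 0) = s * (4 * b ^ 3 - 3 * b)"
    "c' (0, 0, 3) = s * (4 * d ^ 3 - 3 * d)" "c' (2, 1, 0) = 3 * (s * (4 * a\<^sup>2 * b - b))"
    "c' (2, 0, 1) = 3 * (s * (4 * a\<^sup>2 * d - d))" "c' (1, 2, 0) = 3 * (s * (4 * a * b\<^sup>2 - a))"
    "c' (0, 2, 1) = 3 * (s * (4 * b\<^sup>2 * d - d))" "c' (1, 0, 2) = 3 * (s * (4 * a * d\<^sup>2 - a))"
    "c' (0, 1, 2) = 3 * (s * (4 * b * d\<^sup>2 - b))" "c' (1, 1, 1) = 6 * (s * (4 * a * b * d))"
    by (simp_all add: c'_def multinom3_def fact_numeral algebra_simps)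
  have c'_div: "c' (2, 1, 0) / 3 = s * (4 * a\<^sup>2 * b - b)"
    "c' (2, 0, 1) / 3 = s * (4 * a\<^sup>2 * d - d)" "c' (1, 2, 0) / 3 = s * (4 * a * b\<^sup>2 - a)"
    "c' (0, 2, 1) / 3 = s * (4 * b\<^sup>2 * d - d)" "c' (1, 0, 2) / 3 = s * (4 * a * d\<^sup>2 - a)"
    "c' (0, 1, 2) / 3 = s * (4 * b * d\<^sup>2 - b)" "c' (1, 1, 1) / 6 = s * (4 * a * b * d)"
    unfolding c'_eq by simp_all
  have "cubic_polar c x x x = cubic_polar c' x x x" for x
  proof -
    have "cubic_polar c x x x = s * (4 * (x \<bullet> u) ^ 3 - 3 * (x \<bullet> u) * (x \<bullet> x))"
      using CO_act_Ch33[OF assms(1)] by (simp add: eval3_eq_cubic_polar[symmetric] c u_def)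
    also have "\<dots> = cubic_polar c' x x x"
      unfolding cubic_polar_def c'_div c'_eq(1-3) inner_vec_def sum_3 a_def[symmetric] b_def[symmetric]
        d_def[symmetric] inner_real_def
      by algebra
    finally show ?thesis .
  qed
  from coefficients_from_values[OF this]
  have "(bnorm c)\<^sup>2 = (bnorm c')\<^sup>2"
    by (simp add: bnorm_def)
  \<comment> \<open>The terms are the squared Bombieri norm of \<open>4 * (x \<bullet> u)^3\<close>,
    the cross term, and the squared norm of \<open>3 * (x \<bullet> u) * (x \<bullet> x)\<close>;
    for unit \<open>u\<close> they add up to 16 - 24 + 15 = 7.\<close>
  also have "\<dots> = s\<^sup>2 * (16 * (a\<^sup>2 + b\<^sup>2 + d\<^sup>2) ^ 3 - 24 * (a\<^sup>2 + b\<^sup>2 + d\<^sup>2)\<^sup>2 + 15 * (a\<^sup>2 + b\<^sup>2 + d\<^sup>2))"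
  proof -
    have "(bnorm c')\<^sup>2 = s\<^sup>2 * ((4 * a ^ 3 - 3 * a)\<^sup>2 + (4 * b ^ 3 - 3 * b)\<^sup>2 + (4 * d ^ 3 - 3 * d)\<^sup>2
        + 3 * ((4 * a\<^sup>2 * b - b)\<^sup>2 + (4 * a\<^sup>2 * d - d)\<^sup>2 + (4 * a * b\<^sup>2 - a)\<^sup>2
          + (4 * b\<^sup>2 * d - d)\<^sup>2 + (4 * a * d\<^sup>2 - a)\<^sup>2 + (4 * b * d\<^sup>2 - b)\<^sup>2)
        + 6 * (4 * a * b * d)\<^sup>2)"
      unfolding bnorm_square c'_eq power_mult_distrib[of 3] power_mult_distrib[of 6] power_mult_distrib[of s]
      by (simp add: distrib_left)
    also have "\<dots> = s\<^sup>2 * (16 * (a\<^sup>2 + b\<^sup>2 + d\<^sup>2) ^ 3 - 24 * (a\<^sup>2 + b\<^sup>2 + d\<^sup>2)\<^sup>2 + 15 * (a\<^sup>2 + b\<^sup>2 + d\<^sup>2))"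
      by algebra
    finally show ?thesis .
  qed
  finally show ?thesis
    by (simp add: abd)
qed

lemma unorm_CO_act_Ch33_le:
  assumes "orthogonal_transformation \<rho>" "eval3 c = CO_act s \<rho> Ch33" "s > 0"
  shows "unorm c \<le> s"
  unfolding unorm_def
proof (rule cSUP_least)
  fix x :: "real^3" assume "x \<in> sphere 0 1"
  then have "norm (inv \<rho> x) = 1"
    using orthogonal_transformation_norm[OF orthogonal_transformation_inv[OF assms(1)], of x] by simp
  then show "\<bar>eval3 c x\<bar> \<le> s"
    using abs_Ch33_le[of "inv \<rho> x"] \<open>s > 0\<close> by (simp add: assms(2) CO_act_def abs_mult)
qed auto

theorem theorem1p2:
  fixes c :: "nat \<times> nat \<times> nat \<Rightarrow> real"
  assumes "cubic_form c" and "c \<noteq> (\<lambda>_. 0)"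
  shows "unorm c / bnorm c \<ge> 1 / sqrt 7 \<and>
         (\<forall>s \<rho>. s > 0 \<and> orthogonal_transformation \<rho> \<and> eval3 c = CO_act s \<rho> Ch33
           \<longrightarrow> unorm c / bnorm c = 1 / sqrt 7)"
proof -
  have pos: "0 < bnorm c"
    using assms by (rule bnorm_pos)
  have "(bnorm c)\<^sup>2 \<le> (sqrt 7 * unorm c)\<^sup>2"
    using bnorm_square_le(1) by (simp add: power_mult_distrib)
  then have "bnorm c \<le> sqrt 7 * unorm c"
    by (rule power2_le_imp_le) (use bnorm_square_le(2) in simp)
  then have lower: "1 / sqrt 7 \<le> unorm c / bnorm c"
    using pos by (simp add: field_simps)
  moreover have "unorm c / bnorm c = 1 / sqrt 7"
    if "s > 0" "orthogonal_transformation \<rho>" "eval3 c = CO_act s \<rho> Ch33" for s \<rho>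
  \<comment> \<open>The general lower bound supplies one direction, so
    \<open>unorm c \<le> s\<close> suffices and no maximiser has to be exhibited.\<close>
  proof (rule antisym[OF _ lower])
    have "sqrt (7 * s\<^sup>2) = bnorm c"
      by (rule real_sqrt_unique) (use bnorm_square_CO_act_Ch33[OF that(2,3)] pos in auto)
    then have "bnorm c = sqrt 7 * s"
      using \<open>s > 0\<close> by (simp add: real_sqrt_mult)
    moreover have "unorm c \<le> s"
      using that by (intro unorm_CO_act_Ch33_le)
    ultimately show "unorm c / bnorm c \<le> 1 / sqrt 7"
      using \<open>s > 0\<close> by (simp add: field_simps)
  qed
  ultimately show ?thesis
    by blast
qed

end
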